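(* Let $k\ge1$ and let $A$ be a $k\times k$ strictly upper triangular matrix of integers such that every integer sequence $(\lambda_1,\ldots,\lambda_k)$ satisfying $\lambda_i\ge\sum_{j=i+1}^kA[i,j]\lambda_j$ ($1\le i\le k$) is a partition (i.e. $\lambda_1\ge\lambda_2\ge\cdots\ge\lambda_k\ge0$). Let \[G(x,y)=\sum_{\lambda}x^{\lambda_1+\lambda_3+\lambda_5+\cdots}y^{\lambda_2+\lambda_4+\cdots},\] the sum over all such sequences $\lambda$. Let $\alpha\ge1$ and $\beta\le\alpha$ be integers. Consider the set of integer sequences $(\lambda_0,\lambda_1,\ldots,\lambda_k)$ such that $\lambda_i\ge\sum_{j=i+1}^kA[i,j]\lambda_j$ for $1\le i\le k$ and \[\lambda_0=\alpha(\lambda_1+\lambda_3+\lambda_5+\cdots)-\beta(\lambda_2+\lambda_4+\lambda_6+\cdots).\] Then \[\sum x^{\lambda_0+\lambda_2+\lambda_4+\cdots}\,y^{\lambda_1+\lambda_3+\lambda_5+\cdots}=G(x^\alpha y,\,x^{1-\beta}),\] the sum over this set (i.e. its generating function by the sums of the parts in odd positions and in even positions, when $\lambda_0$ is regarded as the first part). *)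

theory Defs
  imports
    "HOL-Analysis.Analysis"
    "HOL-Computational_Algebra.Formal_Power_Series"
    "HOL-Computational_Algebra.Formal_Laurent_Series"
begin

(* Finite sequences are extensional functions on their index set, so that each sequence
   is represented exactly once. Matrices are functions of 1-based indices in {1..k}. *)

definition strictly_upper_triangular :: "nat \<Rightarrow> (nat \<Rightarrow> nat \<Rightarrow> int) \<Rightarrow> bool" where
  "strictly_upper_triangular k A \<longleftrightarrow> (\<forall>i\<in>{1..k}. \<forall>j\<in>{1..k}. j \<le> i \<longrightarrow> A i j = 0)"

definition satisfies_constraints :: "nat \<Rightarrow> (nat \<Rightarrow> nat \<Rightarrow> int) \<Rightarrow> (nat \<Rightarrow> int) \<Rightarrow> bool" where
  "satisfies_constraints k A l \<longleftrightarrow> (\<forall>i\<in>{1..k}. l i \<ge> (\<Sum>j=i+1..k. A i j * l j))"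

definition is_partition :: "nat \<Rightarrow> (nat \<Rightarrow> int) \<Rightarrow> bool" where
  "is_partition k l \<longleftrightarrow> (\<forall>i\<in>{1..<k}. l i \<ge> l (i + 1)) \<and> l k \<ge> 0"

definition constrained_seqs :: "nat \<Rightarrow> (nat \<Rightarrow> nat \<Rightarrow> int) \<Rightarrow> (nat \<Rightarrow> int) set" where
  "constrained_seqs k A = {l \<in> {1..k} \<rightarrow>\<^sub>E UNIV. satisfies_constraints k A l}"

definition odd_index_sum :: "nat set \<Rightarrow> (nat \<Rightarrow> int) \<Rightarrow> int" where
  "odd_index_sum I l = (\<Sum>i\<in>{i\<in>I. odd i}. l i)"

definition even_index_sum :: "nat set \<Rightarrow> (nat \<Rightarrow> int) \<Rightarrow> int" where
  "even_index_sum I l = (\<Sum>i\<in>{i\<in>I. even i}. l i)"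

definition extended_seqs ::
    "nat \<Rightarrow> (nat \<Rightarrow> nat \<Rightarrow> int) \<Rightarrow> int \<Rightarrow> int \<Rightarrow> (nat \<Rightarrow> int) set" where
  "extended_seqs k A \<alpha> \<beta> =
     {l \<in> {0..k} \<rightarrow>\<^sub>E UNIV. satisfies_constraints k A l \<and>
        l 0 = \<alpha> * odd_index_sum {1..k} l - \<beta> * even_index_sum {1..k} l}"

(* G(x,y) is an element of Z[[y]][[x]]: the outer variable is x, the inner one is y.
   All infinite sums below are unordered sums in the library's metric topology on fps,
   in which the outer variable is small and coefficients are discrete.
   Converting exponents to nat loses nothing when every sequence is a partition. *)

definition G_term :: "nat \<Rightarrow> (nat \<Rightarrow> int) \<Rightarrow> int fps fps" where
  "G_term k l =
     fps_X ^ nat (odd_index_sum {1..k} l) * fps_const (fps_X ^ nat (even_index_sum {1..k} l))"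

definition G_series :: "nat \<Rightarrow> (nat \<Rightarrow> nat \<Rightarrow> int) \<Rightarrow> int fps fps" where
  "G_series k A = (\<Sum>\<^sub>\<infinity>l\<in>constrained_seqs k A. G_term k l)"

(* Substitution F(u,v) is the sum over (m,n) of [x^m y^n]F * u^m * v^n, in any topological ring. *)

definition subst_term ::
    "int fps fps \<Rightarrow> 'a :: {comm_ring_1,t2_space} \<Rightarrow> 'a \<Rightarrow> nat \<times> nat \<Rightarrow> 'a" where
  "subst_term F u v = (\<lambda>(m, n). of_int (fps_nth (fps_nth F m) n) * u ^ m * v ^ n)"

definition fps2_subst :: "int fps fps \<Rightarrow> 'a :: {comm_ring_1,t2_space} \<Rightarrow> 'a \<Rightarrow> 'a" where
  "fps2_subst F u v = (\<Sum>\<^sub>\<infinity>p. subst_term F u v p)"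

(* The identity is stated in Z((x))[[y]], since 1 - \<beta> may be negative:
   here the outer variable is y and the inner, Laurent, variable is x. *)

definition xpow :: "int \<Rightarrow> int fls fps" where
  "xpow e = fps_const (fls_X_intpow e)"

definition yvar :: "int fls fps" where
  "yvar = fps_X"

definition extended_term :: "nat \<Rightarrow> (nat \<Rightarrow> int) \<Rightarrow> int fls fps" where
  "extended_term k l =
     xpow (even_index_sum {0..k} l) * yvar ^ nat (odd_index_sum {0..k} l)"

end

theory Submission
  imports Defs
begin

text \<open>
  Regard a sequence with odd-position sum \<open>N\<close> and even-position sum \<open>E\<close> as a monomial of
  \<open>y\<close>-degree \<open>N\<close>. The prescribed \<open>\<lambda>\<^sub>0\<close> is determined by the remaining parts, and
  \<open>\<lambda>\<^sub>0 + E = \<alpha>N + (1 - \<beta>)E\<close>, so the extended sequence contributes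
  \<open>(x\<^sup>\<alpha>y)\<^sup>N (x\<^sup>1\<^sup>-\<^sup>\<beta>)\<^sup>E\<close>, which is the image of the monomial of \<open>G\<close> under the substitution. Since
  only finitely many partitions with \<open>k\<close> parts have a given \<open>N\<close>, every \<open>y\<close>-coefficient
  is a finite sum and no convergence question arises in the \<open>x\<close>-direction.
\<close>

text \<open>A sum in the metric of \<open>fps\<close> converges once each coefficient receives only
  finitely many nonzero contributions. The \<open>n\<close>-th coefficient sees only indices of
  degree \<open>n\<close>, so finite degree classes suffice, whatever the \<open>c i\<close>
  are.\<close>

lemma has_sum_fps_graded:
  fixes c :: "'i \<Rightarrow> 'a :: comm_ring_1" and d :: "'i \<Rightarrow> nat"
  assumes "\<And>n. finite {i \<in> S. d i = n}"
  shows "((\<lambda>i. fps_X ^ d i * fps_const (c i)) has_sum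
           Abs_fps (\<lambda>n. \<Sum>i | i \<in> S \<and> d i = n. c i)) S"
proof (rule has_sum_fpsI)
  fix n :: nat
  have nth: "fps_nth (fps_X ^ d i * fps_const (c i)) n = (if d i = n then c i else 0)" for i
    by (auto simp: fps_X_power_mult_nth)
  show "finite {i \<in> S. fps_nth (fps_X ^ d i * fps_const (c i)) n \<noteq> 0}"
    by (rule finite_subset[OF _ assms[of n]]) (auto simp: nth)
  show "fps_nth (Abs_fps (\<lambda>n. \<Sum>i | i \<in> S \<and> d i = n. c i)) n =
    (\<Sum>i | i \<in> S \<and> fps_nth (fps_X ^ d i * fps_const (c i)) n \<noteq> 0.
       fps_nth (fps_X ^ d i * fps_const (c i)) n)"
    using assms[of n] unfolding nth fps_nth_Abs_fps
    by (intro sum.mono_neutral_cong_right) auto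
qed

text \<open>The coefficients of \<open>F\<close> count the indices with a given pair of exponents,
  so the substitution regroups the sum of the monomials in \<open>a\<close> and \<open>b\<close>.
  Only the outer variable forces convergence: each \<open>m\<close> comes with finitely many
  exponents of \<open>b\<close>. Hence \<open>b\<close> may be a negative Laurent power.\<close>

lemma has_sum_subst_term_graded:
  fixes a b :: "'a :: comm_ring_1" and d e :: "'i \<Rightarrow> nat"
  assumes fin: "\<And>m. finite {i \<in> S. d i = m}"
  defines "F \<equiv> Abs_fps (\<lambda>m. \<Sum>i | i \<in> S \<and> d i = m. fps_X ^ e i)"
  shows "(subst_term F (fps_const a * fps_X) (fps_const b) has_sum
           Abs_fps (\<lambda>m. \<Sum>i | i \<in> S \<and> d i = m. a ^ d i * b ^ e i)) UNIV"
proof -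
  \<comment> \<open>\<open>T\<close> holds the exponent pairs that occur, \<open>N\<close> their
    multiplicities. In \<open>UNIV\<close> a fixed \<open>m\<close> belongs to infinitely many
    pairs, so \<open>has_sum_fps_graded\<close> is applied over \<open>T\<close>; the terms outside
    \<open>T\<close> vanish.\<close>
  define T where "T = (\<lambda>i. (d i, e i)) ` S"
  define N where "N m n = card {i \<in> S. d i = m \<and> e i = n}" for m n
  have F_nth: "fps_nth (fps_nth F m) n = int (N m n)" for m n
  proof -
    have "{i \<in> S. d i = m} \<inter> {i. n = e i} = {i \<in> S. d i = m \<and> e i = n}" by auto
    then show ?thesis
      using fin[of m] by (simp add: F_def N_def fps_sum_nth sum.If_cases)
  qed
  define g where "g = (\<lambda>(m, n). of_nat (N m n) * (a ^ m * b ^ n))"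
  have term_eq: "subst_term F (fps_const a * fps_X) (fps_const b) p
      = fps_X ^ fst p * fps_const (g p)" for p
    by (cases p) (simp add: subst_term_def F_nth g_def power_mult_distrib fps_const_power
      fps_of_nat[symmetric] mult_ac flip: fps_const_mult)
  have T_m: "{p \<in> T. fst p = m} = (\<lambda>i. (d i, e i)) ` {i \<in> S. d i = m}" for m
    by (auto simp: T_def)
  have "((\<lambda>p. fps_X ^ fst p * fps_const (g p)) has_sum
      Abs_fps (\<lambda>m. \<Sum>p | p \<in> T \<and> fst p = m. g p)) T"
    using fin by (intro has_sum_fps_graded) (simp add: T_m)
  also have "(\<lambda>m. \<Sum>p | p \<in> T \<and> fst p = m. g p) =
      (\<lambda>m. \<Sum>i | i \<in> S \<and> d i = m. a ^ d i * b ^ e i)"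
  proof
    fix m
    let ?L = "{i \<in> S. d i = m}"
    \<comment> \<open>Collect the indices into fibres of \<open>(d i, e i)\<close>: each fibre
      repeats one monomial \<open>N m n\<close> times.\<close>
    have "(\<Sum>i\<in>?L. a ^ d i * b ^ e i) =
        (\<Sum>p\<in>(\<lambda>i. (d i, e i)) ` ?L. \<Sum>i | i \<in> ?L \<and> (d i, e i) = p. a ^ d i * b ^ e i)"
      by (rule sum.image_gen[OF fin])
    also have "\<dots> = (\<Sum>p\<in>(\<lambda>i. (d i, e i)) ` ?L. g p)"
    proof (rule sum.cong[OF refl])
      fix p assume "p \<in> (\<lambda>i. (d i, e i)) ` ?L"
      then obtain n where p: "p = (m, n)" by auto
      have "(\<Sum>i | i \<in> ?L \<and> (d i, e i) = p. a ^ d i * b ^ e i) =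
          (\<Sum>i | i \<in> S \<and> d i = m \<and> e i = n. a ^ m * b ^ n)"
        by (rule sum.cong) (auto simp: p)
      then show "(\<Sum>i | i \<in> ?L \<and> (d i, e i) = p. a ^ d i * b ^ e i) = g p"
        by (simp add: p g_def N_def)
    qed
    finally show "(\<Sum>p | p \<in> T \<and> fst p = m. g p) =
        (\<Sum>i | i \<in> S \<and> d i = m. a ^ d i * b ^ e i)"
      by (simp add: T_m)
  qed
  finally have "((\<lambda>p. fps_X ^ fst p * fps_const (g p)) has_sum
      Abs_fps (\<lambda>m. \<Sum>i | i \<in> S \<and> d i = m. a ^ d i * b ^ e i)) T" .
  moreover have "g p = 0" if "p \<notin> T" for p
  proof -
    have "{i \<in> S. d i = fst p \<and> e i = snd p} = {}"
      using that by (force simp: T_def)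
    then have "N (fst p) (snd p) = 0"
      unfolding N_def by (simp only: card.empty)
    then show ?thesis by (simp add: g_def case_prod_beta)
  qed
  ultimately show ?thesis
    unfolding term_eq by (subst has_sum_cong_neutral[where T = T]) auto
qed

lemma is_partition_antimono:
  assumes "is_partition k l" "1 \<le> i" "i \<le> j" "j \<le> k"
  shows "l j \<le> l i"
  using assms(3,4)
proof (induction j rule: dec_induct)
  case (step m)
  then have "l (Suc m) \<le> l m"
    using assms(1,2) by (auto simp: is_partition_def)
  with step show ?case
    by auto
qed simp

lemma is_partition_nonneg:
  assumes "is_partition k l" "i \<in> {1..k}"
  shows "0 \<le> l i"
  using is_partition_antimono[of k l i k] assms by (auto simp: is_partition_def)

lemma index_sums_nonneg:
  assumes "is_partition k l"
  shows "0 \<le> odd_index_sum {1..k} l" "0 \<le> even_index_sum {1..k} l"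
  unfolding odd_index_sum_def even_index_sum_def
  using is_partition_nonneg[OF assms] by (auto intro!: sum_nonneg)

text \<open>The largest part is the first, which stands in an odd position, and the other
  odd-position parts are nonnegative. This is why the odd-position sum alone controls every
  part.\<close>

lemma is_partition_le_odd_index_sum:
  assumes "is_partition k l" "i \<in> {1..k}"
  shows "l i \<le> odd_index_sum {1..k} l"
proof -
  have "l i \<le> l 1"
    using is_partition_antimono[of k l 1 i] assms by auto
  also have "l 1 \<le> odd_index_sum {1..k} l"
    unfolding odd_index_sum_def
    using assms is_partition_nonneg[OF assms(1)] by (intro member_le_sum) auto
  finally show ?thesis .
qed

text \<open>All parts are confined to \<open>{0..int n}\<close>, and extensionality leaves no
  freedom outside \<open>{1..k}\<close>.\<close>

lemma finite_partitions_odd_index_sum: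
  assumes "S \<subseteq> {1..k} \<rightarrow>\<^sub>E UNIV" "\<And>l. l \<in> S \<Longrightarrow> is_partition k l"
  shows "finite {l \<in> S. nat (odd_index_sum {1..k} l) = n}"
proof (rule finite_subset)
  show "{l \<in> S. nat (odd_index_sum {1..k} l) = n} \<subseteq> {1..k} \<rightarrow>\<^sub>E {0..int n}"
  proof
    fix l assume l: "l \<in> {l \<in> S. nat (odd_index_sum {1..k} l) = n}"
    then have part: "is_partition k l" and sum: "odd_index_sum {1..k} l = int n"
      using assms(2) index_sums_nonneg(1) by auto
    have "l i \<in> {0..int n}" if "i \<in> {1..k}" for i
      using is_partition_nonneg[OF part that] is_partition_le_odd_index_sum[OF part that] sum
      by simp
    then show "l \<in> {1..k} \<rightarrow>\<^sub>E {0..int n}"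
      using l assms(1) by (auto simp: PiE_iff)
  qed
qed (simp add: finite_PiE)

text \<open>Only index 0 is overwritten, where an extensional function on \<open>{1..k}\<close> is
  \<open>undefined\<close>; restriction to \<open>{1..k}\<close> therefore undoes it.\<close>

definition extend_seq :: "nat \<Rightarrow> int \<Rightarrow> int \<Rightarrow> (nat \<Rightarrow> int) \<Rightarrow> nat \<Rightarrow> int" where
  "extend_seq k \<alpha> \<beta> l = l(0 := \<alpha> * odd_index_sum {1..k} l - \<beta> * even_index_sum {1..k} l)"

lemma index_sums_cong:
  assumes "\<And>i. i \<in> I \<Longrightarrow> l i = l' i"
  shows "odd_index_sum I l = odd_index_sum I l'" "even_index_sum I l = even_index_sum I l'"
  using assms by (auto simp: odd_index_sum_def even_index_sum_def intro!: sum.cong)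

lemma satisfies_constraints_cong:
  assumes "\<And>i. i \<in> {1..k} \<Longrightarrow> l i = l' i"
  shows "satisfies_constraints k A l \<longleftrightarrow> satisfies_constraints k A l'"
proof -
  have "(\<Sum>j=i+1..k. A i j * l j) = (\<Sum>j=i+1..k. A i j * l' j)" for i
    using assms by (intro sum.cong) auto
  then show ?thesis
    using assms by (simp add: satisfies_constraints_def)
qed

text \<open>The constraints read only indices from 1 to \<open>k\<close>, so the new part does not
  affect them, and it is itself determined by the other parts.\<close>

lemma bij_betw_extend_seq:
  "bij_betw (extend_seq k \<alpha> \<beta>) (constrained_seqs k A) (extended_seqs k A \<alpha> \<beta>)"
proof (rule bij_betwI[where g = "\<lambda>l. restrict l {1..k}"])
  show "extend_seq k \<alpha> \<beta> \<in> constrained_seqs k A \<rightarrow> extended_seqs k A \<alpha> \<beta>"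
  proof
    fix l assume l: "l \<in> constrained_seqs k A"
    let ?l' = "extend_seq k \<alpha> \<beta> l"
    have eq: "?l' i = l i" if "i \<in> {1..k}" for i
      using that by (simp add: extend_seq_def)
    have sums: "odd_index_sum {1..k} ?l' = odd_index_sum {1..k} l"
      "even_index_sum {1..k} ?l' = even_index_sum {1..k} l"
      by (intro index_sums_cong eq; assumption)+
    have sat: "satisfies_constraints k A ?l'"
      using l satisfies_constraints_cong[of k ?l' l A] eq by (auto simp: constrained_seqs_def)
    have zero: "?l' 0 = \<alpha> * odd_index_sum {1..k} l - \<beta> * even_index_sum {1..k} l"
      by (simp add: extend_seq_def)
    have "extend_seq k \<alpha> \<beta> l \<in> {0..k} \<rightarrow>\<^sub>E UNIV"
      using l by (auto simp: extend_seq_def constrained_seqs_def PiE_iff extensional_def)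
    then show "extend_seq k \<alpha> \<beta> l \<in> extended_seqs k A \<alpha> \<beta>"
      unfolding extended_seqs_def using sums sat zero by simp
  qed
  show "(\<lambda>l. restrict l {1..k}) \<in> extended_seqs k A \<alpha> \<beta> \<rightarrow> constrained_seqs k A"
  proof
    fix l assume "l \<in> extended_seqs k A \<alpha> \<beta>"
    then show "restrict l {1..k} \<in> constrained_seqs k A"
      using satisfies_constraints_cong[of k "restrict l {1..k}" l A]
      by (simp add: extended_seqs_def constrained_seqs_def)
  qed
  show "restrict (extend_seq k \<alpha> \<beta> l) {1..k} = l" if "l \<in> constrained_seqs k A" for l
    using that by (auto simp: extend_seq_def constrained_seqs_def PiE_iff extensional_def)
  show "extend_seq k \<alpha> \<beta> (restrict l {1..k}) = l" if l: "l \<in> extended_seqs k A \<alpha> \<beta>" for l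
  proof
    fix i
    have sums: "odd_index_sum {1..k} (restrict l {1..k}) = odd_index_sum {1..k} l"
      "even_index_sum {1..k} (restrict l {1..k}) = even_index_sum {1..k} l"
      by (auto intro: index_sums_cong)
    show "extend_seq k \<alpha> \<beta> (restrict l {1..k}) i = l i"
      unfolding extend_seq_def fun_upd_apply sums
      using l by (auto simp: extended_seqs_def PiE_iff extensional_def)
  qed
qed

text \<open>Position 0 is even: the new part leaves the odd-position sum alone and joins the even
  one, which turns the coefficient \<open>- \<beta>\<close> into \<open>1 - \<beta>\<close>.\<close>

lemma index_sums_extend_seq:
  "odd_index_sum {0..k} (extend_seq k \<alpha> \<beta> l) = odd_index_sum {1..k} l"
  "even_index_sum {0..k} (extend_seq k \<alpha> \<beta> l) =
     \<alpha> * odd_index_sum {1..k} l + (1 - \<beta>) * even_index_sum {1..k} l"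
proof -
  have odd: "{i \<in> {0..k}. odd i} = {i \<in> {1..k}. odd i}"
    by (auto simp: Suc_le_eq odd_pos)
  have even: "{i \<in> {0..k}. even i} = insert 0 {i \<in> {1..k}. even i}"
    by auto
  have sums: "(\<Sum>i\<in>{i \<in> {1..k}. odd i}. extend_seq k \<alpha> \<beta> l i) = odd_index_sum {1..k} l"
    "(\<Sum>i\<in>{i \<in> {1..k}. even i}. extend_seq k \<alpha> \<beta> l i) = even_index_sum {1..k} l"
    unfolding odd_index_sum_def even_index_sum_def
    by (intro sum.cong; auto simp: extend_seq_def)+
  show "odd_index_sum {0..k} (extend_seq k \<alpha> \<beta> l) = odd_index_sum {1..k} l"
    unfolding odd_index_sum_def[of "{0..k}"] odd sums ..
  have "even_index_sum {0..k} (extend_seq k \<alpha> \<beta> l) =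
      extend_seq k \<alpha> \<beta> l 0 + even_index_sum {1..k} l"
    unfolding even_index_sum_def[of "{0..k}"] even sums(2)[symmetric] by simp
  then show "even_index_sum {0..k} (extend_seq k \<alpha> \<beta> l) =
      \<alpha> * odd_index_sum {1..k} l + (1 - \<beta>) * even_index_sum {1..k} l"
    by (simp add: extend_seq_def algebra_simps)
qed

text \<open>Nonnegativity of both sums makes the conversions to \<open>nat\<close> lossless, so the
  Laurent exponent splits into natural powers, even when \<open>1 - \<beta>\<close> is
  negative.\<close>

lemma extended_term_extend_seq:
  assumes "is_partition k l"
  shows "extended_term k (extend_seq k \<alpha> \<beta> l) =
    fps_X ^ nat (odd_index_sum {1..k} l) *
      fps_const (fls_X_intpow \<alpha> ^ nat (odd_index_sum {1..k} l) *
                 fls_X_intpow (1 - \<beta>) ^ nat (even_index_sum {1..k} l))"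
  unfolding extended_term_def index_sums_extend_seq xpow_def yvar_def fls_X_intpow_power
    fls_X_intpow_times_fls_X_intpow
  using index_sums_nonneg[OF assms] by (simp add: mult.commute)

theorem theorem4:
  fixes k :: nat and A :: "nat \<Rightarrow> nat \<Rightarrow> int" and \<alpha> \<beta> :: int
  assumes "k \<ge> 1"
    and "strictly_upper_triangular k A"
    and "\<And>l. l \<in> constrained_seqs k A \<Longrightarrow> is_partition k l"
    and "\<alpha> \<ge> 1" and "\<beta> \<le> \<alpha>"
  shows "G_term k summable_on constrained_seqs k A \<and>
         extended_term k summable_on extended_seqs k A \<alpha> \<beta> \<and>
         subst_term (G_series k A) (xpow \<alpha> * yvar) (xpow (1 - \<beta>)) summable_on UNIV \<and>
         (\<Sum>\<^sub>\<infinity>l\<in>extended_seqs k A \<alpha> \<beta>. extended_term k l) =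
           fps2_subst (G_series k A) (xpow \<alpha> * yvar) (xpow (1 - \<beta>))"
proof -
  let ?C = "constrained_seqs k A"
  let ?d = "\<lambda>l. nat (odd_index_sum {1..k} l)" and ?e = "\<lambda>l. nat (even_index_sum {1..k} l)"
  let ?a = "fls_X_intpow \<alpha> :: int fls" and ?b = "fls_X_intpow (1 - \<beta>) :: int fls"
  \<comment> \<open>The common value of both sides, written by degree in \<open>y\<close>.\<close>
  let ?R = "Abs_fps (\<lambda>m. \<Sum>l | l \<in> ?C \<and> ?d l = m. ?a ^ ?d l * ?b ^ ?e l)"
  have fin: "finite {l \<in> ?C. ?d l = n}" for n
    using assms(3) by (intro finite_partitions_odd_index_sum) (auto simp: constrained_seqs_def)
  \<comment> \<open>Here the outer variable is \<open>x\<close> and the coefficients are powers of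
    the inner \<open>y\<close>; this is the form of \<open>F\<close> in
    \<open>has_sum_subst_term_graded\<close>.\<close>
  have G: "(G_term k has_sum Abs_fps (\<lambda>m. \<Sum>l | l \<in> ?C \<and> ?d l = m. fps_X ^ ?e l)) ?C"
    using has_sum_fps_graded[OF fin, where c = "\<lambda>l. fps_X ^ ?e l"]
    unfolding G_term_def .
  have subst: "(subst_term (G_series k A) (xpow \<alpha> * yvar) (xpow (1 - \<beta>)) has_sum ?R) UNIV"
    using has_sum_subst_term_graded[OF fin, of ?e ?a ?b]
    by (simp add: G_series_def infsumI[OF G] xpow_def yvar_def)
  have "((\<lambda>l. extended_term k (extend_seq k \<alpha> \<beta> l)) has_sum ?R) ?C"
    using has_sum_fps_graded[OF fin, where c = "\<lambda>l. ?a ^ ?d l * ?b ^ ?e l"]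
    by (subst has_sum_cong[OF extended_term_extend_seq[OF assms(3)]])
  then have ext: "(extended_term k has_sum ?R) (extended_seqs k A \<alpha> \<beta>)"
    using has_sum_reindex_bij_betw[OF bij_betw_extend_seq] by blast
  show ?thesis
    using G ext subst by (auto simp: fps2_subst_def summable_on_def infsumI)
qed

end
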